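(* Let $3/2<p<\infty$, let $g\in L^p(\mathbb{D})$, and let $G[g]$ be the Green potential of $g$. Then: (1) if $3/2<p<2$, then $G[g]\in C^{\mu}(\mathbb{D})$, where $\mu=2/p-1$; (2) if $2<p<\infty$, then $G[g]\in C^{1,\nu}(\mathbb{D})$, where $\nu=1-2/p$.
   Context: $\mathbb{D}=\{z\in\mathbb{C}:|z|<1\}$ is the unit disk and $\mathrm{d}A=\frac{1}{\pi}\,\mathrm{d}x\,\mathrm{d}y$ is the normalized area measure. For $1\le p<\infty$, $L^p(\mathbb{D})$ is the space of complex-valued measurable functions $f$ on $\mathbb{D}$ with $\|f\|_p=\left(\int_{\mathbb{D}}|f|^p\,\mathrm{d}A\right)^{1/p}<\infty$. The Green potential of $g$ is $$G[g](z)=\int_{\mathbb{D}}\log\left|\frac{z-\tau}{1-\bar z\tau}\right|^2 g(\tau)\,\mathrm{d}A(\tau),\qquad z\in\mathbb{D}.$$ For $0<\mu\le1$, $C^{\mu}(\mathbb{D})$ is the space of continuous functions $f:\mathbb{D}\to\mathbb{C}$ with $$\sup_{z\ne w,\ z,w\in\mathbb{D}}\frac{|f(z)-f(w)|}{|z-w|^{\mu}}<\infty.$$ For $0<\nu\le1$, $C^{1,\nu}(\mathbb{D})$ is the space of $C^1$ functions $f:\mathbb{D}\to\mathbb{C}$ with $$\sup_{z\ne w,\ z,w\in\mathbb{D}}\frac{|\nabla f(z)-\nabla f(w)|}{|z-w|^{\nu}}<\infty.$$ *)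

theory Defs
  imports "HOL-Analysis.Analysis"
begin

text \<open>Functions on the unit disk are total functions on the complex plane of which only the
  values on the disk matter.\<close>

abbreviation unit_disk :: "complex set" where
  "unit_disk \<equiv> ball 0 1"

definition area_measure :: "complex measure" where
  "area_measure = scale_measure (ennreal (1 / pi)) (lebesgue_on unit_disk)"

definition Lp_disk :: "real \<Rightarrow> (complex \<Rightarrow> complex) set" where
  "Lp_disk p = {f \<in> borel_measurable area_measure.
     (\<integral>\<^sup>+ z. ennreal (cmod (f z) powr p) \<partial>area_measure) < \<infinity>}"

text \<open>The convention \<^term>\<open>ln (0::real) = 0\<close> only affects the integrand at the single
  point \<open>\<tau> = z\<close>, which is a null set.\<close>

definition green_potential :: "(complex \<Rightarrow> complex) \<Rightarrow> complex \<Rightarrow> complex" where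
  "green_potential g z =
     (LINT \<tau>|area_measure.
        complex_of_real (ln ((cmod ((z - \<tau>) / (1 - cnj z * \<tau>)))\<^sup>2)) * g \<tau>)"

definition holder_disk :: "real \<Rightarrow> (complex \<Rightarrow> complex) set" where
  "holder_disk \<mu> = {f. continuous_on unit_disk f \<and>
     bdd_above {cmod (f z - f w) / cmod (z - w) powr \<mu> |z w.
       z \<in> unit_disk \<and> w \<in> unit_disk \<and> z \<noteq> w}}"

text \<open>The gradient consists of the two real partial derivatives \<open>(f\<^sub>x, f\<^sub>y)\<close>, obtained from the
  real Frechet derivative in the directions \<^term>\<open>1::complex\<close> and \<^term>\<open>\<i>\<close>; the product norm
  is the Euclidean one.\<close>

definition grad :: "(complex \<Rightarrow> complex) \<Rightarrow> complex \<Rightarrow> complex \<times> complex" where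
  "grad f z = (frechet_derivative f (at z) 1, frechet_derivative f (at z) \<i>)"

definition C1_disk :: "(complex \<Rightarrow> complex) set" where
  "C1_disk = {f. (\<forall>z\<in>unit_disk. f differentiable (at z)) \<and> continuous_on unit_disk (grad f)}"

definition C1_holder_disk :: "real \<Rightarrow> (complex \<Rightarrow> complex) set" where
  "C1_holder_disk \<nu> = {f \<in> C1_disk.
     bdd_above {norm (grad f z - grad f w) / cmod (z - w) powr \<nu> |z w.
       z \<in> unit_disk \<and> w \<in> unit_disk \<and> z \<noteq> w}}"

end

theory Submission
  imports Defs
begin

text \<open>
  With \<open>x\<^sup>*\<close> the conjugate of \<open>x\<close>, the Green kernel is
  \<open>ln \<bar>z - x\<bar>\<^sup>2 - ln \<bar>1 - z x\<^sup>*\<bar>\<^sup>2\<close>. On the disk \<open>\<bar>1 - z x\<^sup>*\<bar> \<ge> \<bar>z - x\<bar>\<close>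
  (\<open>cmod_diff_le_reflected\<close>), and the values of \<open>1 - z x\<^sup>*\<close> at \<open>z\<close> and \<open>w\<close> differ by at most \<open>\<bar>z - w\<bar>\<close>. Hence any
  bound for increments of \<open>ln \<bar>z - x\<bar>\<^sup>2\<close> that decreases as the moduli grow holds for the second logarithm
  too, and the kernel behaves like the logarithmic kernel of the plane. All regularity is obtained by
  bounding increments of the kernel pointwise and pairing the bound with \<open>g\<close>
  (\<open>Lp_pairing_bound\<close>, with \<open>q = p / (p - 1)\<close> the conjugate exponent).

  For \<open>p < 2\<close> the pointwise bound is
  \<open>\<bar>ln \<bar>a\<bar>\<^sup>2 - ln \<bar>b\<bar>\<^sup>2\<bar> \<le> C \<bar>a - b\<bar>\<^bsup>\<mu>\<^esup> (\<bar>a\<bar>\<^bsup>- \<mu>\<^esup> + \<bar>b\<bar>\<^bsup>- \<mu>\<^esup>)\<close>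
  (\<open>ln_cmod_diff_le_powr\<close>), and \<open>\<bar>a\<bar>\<^bsup>- \<mu>\<^esup>\<close> is in \<open>L\<^sup>q\<close> because \<open>\<mu> q < 2\<close>.

  For \<open>p > 2\<close> one has \<open>q < 2\<close>, and the single integral
  \<open>\<integral> (\<bar>z - x\<bar> \<bar>w - x\<bar>)\<^bsup>- q\<^esup> dx \<le> C \<bar>z - w\<bar>\<^bsup>2 - 2 q\<^esup>\<close> (\<open>nn_integral_powr_pair\<close>) gives everything.
  The difference of \<open>1 / (z - x)\<close> and \<open>1 / (w - x)\<close> is \<open>\<bar>z - w\<bar> / (\<bar>z - x\<bar> \<bar>w - x\<bar>)\<close> in modulus, which yields
  the Hoelder estimate of the gradient. The first-order Taylor remainder of the kernel is at most
  \<open>8 \<bar>z - w\<bar>\<^sup>2 / (\<bar>z - x\<bar> \<bar>w - x\<bar>)\<close> (\<open>green_kernel_taylor\<close>), so the same integral shows that the potential has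
  a first-order expansion with error of order \<open>\<bar>z - w\<bar>\<^bsup>1 + \<nu>\<^esup>\<close>, hence is differentiable.
\<close>

section \<open>Integrals of powers of the distance in the plane\<close>

lemma ennreal_term_le_suminf: "f n \<le> (\<Sum>n. f n :: ennreal)"
  using sum_le_suminf[OF summableI, of "{n}" f] by simp

text \<open>A disk of radius \<open>r\<close> has area \<open>\<pi> r\<^sup>2\<close>, so a function dominated by a dyadic
  superposition of disks is integrated by summing a geometric series. Both radial integrals below are of this kind.\<close>

lemma nn_integral_le_geometric_sum_of_balls:
  fixes z :: complex and f :: "complex \<Rightarrow> ennreal"
  assumes r: "\<And>n. 0 \<le> r n" and c: "\<And>n. 0 \<le> c n"
    and le: "\<And>x. f x \<le> (\<Sum>n. ennreal (c n) * indicator (ball z (r n)) x)"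
    and geo: "\<And>n. c n * (r n)\<^sup>2 = B * \<rho> ^ n"
    and B: "0 \<le> B" "0 \<le> \<rho>" "\<rho> < 1"
  shows "(\<integral>\<^sup>+ x. f x \<partial>lborel) \<le> ennreal (pi * B / (1 - \<rho>))"
proof -
  have [measurable]: "ball z (r n) \<in> sets borel" for n by simp
  have "(\<integral>\<^sup>+ x. f x \<partial>lborel)
      \<le> (\<integral>\<^sup>+ x. (\<Sum>n. ennreal (c n) * indicator (ball z (r n)) x) \<partial>lborel)"
    by (intro nn_integral_mono le)
  also have "\<dots> = (\<Sum>n. \<integral>\<^sup>+ x. ennreal (c n) * indicator (ball z (r n)) x \<partial>lborel)"
    by (intro nn_integral_suminf) measurable
  also have "\<dots> = (\<Sum>n. ennreal (pi * B * \<rho> ^ n))"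
  proof (intro suminf_cong)
    fix n
    have "(\<integral>\<^sup>+ x. ennreal (c n) * indicator (ball z (r n)) x \<partial>lborel)
        = ennreal (c n) * emeasure lborel (ball z (r n))"
      by (subst nn_integral_cmult_indicator) auto
    also have "\<dots> = ennreal (c n * (pi * (r n)\<^sup>2))"
      using r c by (simp add: emeasure_ball unit_ball_vol_2 ennreal_mult)
    also have "c n * (pi * (r n)\<^sup>2) = pi * B * \<rho> ^ n"
      using geo[of n] by (simp add: mult.left_commute)
    finally show "(\<integral>\<^sup>+ x. ennreal (c n) * indicator (ball z (r n)) x \<partial>lborel)
        = ennreal (pi * B * \<rho> ^ n)" .
  qed
  also have "\<dots> = ennreal (pi * B * (1 / (1 - \<rho>)))"
    using B by (intro suminf_ennreal_eq sums_mult geometric_sums) auto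
  finally show ?thesis by simp
qed

text \<open>Decompose the punctured disk into the annuli \<open>R / 2\<^bsup>n + 1\<^esup> \<le> \<bar>z - x\<bar> < R / 2\<^sup>n\<close>. Each one contributes
  at most a constant times \<open>(R / 2\<^sup>n)\<^bsup>2 - s\<^esup>\<close>, which is summable as \<open>s < 2\<close>.\<close>

lemma nn_integral_powr_near:
  fixes z :: complex
  assumes s: "0 \<le> s" "s < 2" and R: "0 < R"
  shows "(\<integral>\<^sup>+ x. ennreal (cmod (z - x) powr (- s)) * indicator (ball z R) x \<partial>lborel)
    \<le> ennreal (pi * 2 powr s / (1 - 2 powr (s - 2)) * R powr (2 - s))"
proof -
  let ?c = "\<lambda>n::nat. (R / 2 ^ (n + 1)) powr (- s)" and ?r = "\<lambda>n::nat. R / 2 ^ n"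
  have "(\<integral>\<^sup>+ x. ennreal (cmod (z - x) powr (- s)) * indicator (ball z R) x \<partial>lborel)
      \<le> ennreal (pi * (2 powr s * R powr (2 - s)) / (1 - 2 powr (s - 2)))"
  proof (rule nn_integral_le_geometric_sum_of_balls)
    fix x
    show "ennreal (cmod (z - x) powr (- s)) * indicator (ball z R) x
        \<le> (\<Sum>n. ennreal (?c n) * indicator (ball z (?r n)) x)"
    proof (cases "x \<noteq> z \<and> x \<in> ball z R")
      case True
      define d where "d = cmod (z - x)"
      have d: "0 < d" "d < R"
        using True by (auto simp: d_def dist_norm)
      obtain m where "R / d < 2 ^ m"
        using real_arch_pow[of 2 "R / d"] by auto
      hence "\<exists>n. R / 2 ^ (n + 1) \<le> d"
        using d by (intro exI[of _ m]) (auto simp: field_simps)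
      define n where "n = (LEAST n. R / 2 ^ (n + 1) \<le> d)"
      have n1: "R / 2 ^ (n + 1) \<le> d"
        unfolding n_def using \<open>\<exists>n. _ n\<close> by (rule LeastI_ex)
      have n2: "d < R / 2 ^ n"
      proof (cases n)
        case (Suc k)
        hence "\<not> R / 2 ^ (k + 1) \<le> d"
          using not_less_Least[of k "\<lambda>n. R / 2 ^ (n + 1) \<le> d"] by (simp add: n_def)
        thus ?thesis using Suc by simp
      qed (use d in auto)
      have "ennreal (d powr (- s)) \<le> ennreal (?c n) * indicator (ball z (?r n)) x"
        using n1 n2 R s by (auto simp: d_def dist_norm intro!: ennreal_leI powr_mono2')
      also have "\<dots> \<le> (\<Sum>n. ennreal (?c n) * indicator (ball z (?r n)) x)"
        by (rule ennreal_term_le_suminf)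
      finally show ?thesis
        using True by (simp add: d_def)
    qed auto
  next
    fix n
    have "?c n = R powr (- s) * (2 powr s * (2 powr s) ^ n)"
    proof -
      have "?c n = R powr (- s) * (2 ^ (n + 1)) powr s"
        using R by (simp add: powr_divide powr_minus_divide)
      also have "(2 ^ (n + 1)) powr s = ((2::real) powr s) ^ (n + 1)"
        by (metis powr_power powr_realpow powr_powr zero_less_numeral zero_neq_numeral mult.commute)
      finally show ?thesis by simp
    qed
    moreover have "((2::real) powr (s - 2)) ^ n = (2 powr s) ^ n / 4 ^ n"
      by (simp add: powr_diff power_divide)
    moreover have "(?r n)\<^sup>2 = R\<^sup>2 / 4 ^ n"
      by (simp add: power_divide power2_eq_square flip: power_mult_distrib)
    moreover have "R powr (2 - s) = R powr (- s) * R\<^sup>2"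
      using R by (simp add: powr_diff powr_minus_divide)
    ultimately show "?c n * (?r n)\<^sup>2 = 2 powr s * R powr (2 - s) * (2 powr (s - 2)) ^ n"
      by (simp only:) simp
  next
    show "(2::real) powr (s - 2) < 1"
      using s powr_less_mono[of "s - 2" 0 2] by simp
  qed (use R in auto)
  thus ?thesis by (simp add: mult.assoc)
qed

text \<open>The annuli \<open>R 2\<^sup>n \<le> \<bar>z - x\<bar> < R 2\<^bsup>n + 1\<^esup>\<close> now go outwards, and the contributions
  \<open>(R 2\<^sup>n)\<^bsup>2 - s\<^esup>\<close> decay as \<open>s > 2\<close>.\<close>

lemma nn_integral_powr_far:
  fixes z :: complex
  assumes s: "2 < s" and R: "0 < R"
  shows "(\<integral>\<^sup>+ x. ennreal (cmod (z - x) powr (- s)) * indicator (- ball z R) x \<partial>lborel)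
    \<le> ennreal (4 * pi / (1 - 2 powr (2 - s)) * R powr (2 - s))"
proof -
  let ?c = "\<lambda>n::nat. (R * 2 ^ n) powr (- s)" and ?r = "\<lambda>n::nat. R * 2 ^ (n + 1)"
  have "(\<integral>\<^sup>+ x. ennreal (cmod (z - x) powr (- s)) * indicator (- ball z R) x \<partial>lborel)
      \<le> ennreal (pi * (4 * R powr (2 - s)) / (1 - 2 powr (2 - s)))"
  proof (rule nn_integral_le_geometric_sum_of_balls)
    fix x
    show "ennreal (cmod (z - x) powr (- s)) * indicator (- ball z R) x
        \<le> (\<Sum>n. ennreal (?c n) * indicator (ball z (?r n)) x)"
    proof (cases "x \<in> ball z R")
      case False
      define d where "d = cmod (z - x)"
      have d: "R \<le> d"
        using False by (auto simp: d_def dist_norm)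
      obtain m where "d / R < 2 ^ m"
        using real_arch_pow[of 2 "d / R"] by auto
      moreover have "(2::real) ^ m \<le> 2 ^ (m + 1)" by simp
      ultimately have "d / R < 2 ^ (m + 1)" by linarith
      hence "\<exists>n. d < R * 2 ^ (n + 1)"
        using R by (intro exI[of _ m]) (auto simp: field_simps)
      define n where "n = (LEAST n. d < R * 2 ^ (n + 1))"
      have n1: "d < R * 2 ^ (n + 1)"
        unfolding n_def using \<open>\<exists>n. _ n\<close> by (rule LeastI_ex)
      have n2: "R * 2 ^ n \<le> d"
      proof (cases n)
        case (Suc k)
        hence "\<not> d < R * 2 ^ (k + 1)"
          using not_less_Least[of k "\<lambda>n. d < R * 2 ^ (n + 1)"] by (simp add: n_def)
        thus ?thesis using Suc by simp
      qed (use d in auto)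
      have "ennreal (d powr (- s)) \<le> ennreal (?c n) * indicator (ball z (?r n)) x"
        using n1 n2 R s by (auto simp: d_def dist_norm intro!: ennreal_leI powr_mono2')
      also have "\<dots> \<le> (\<Sum>n. ennreal (?c n) * indicator (ball z (?r n)) x)"
        by (rule ennreal_term_le_suminf)
      finally show ?thesis
        using False by (simp add: d_def)
    qed auto
  next
    fix n
    have "?c n = R powr (- s) * (2 powr (- s)) ^ n"
    proof -
      have "?c n = R powr (- s) * (2 ^ n) powr (- s)"
        using R by (simp add: powr_mult)
      also have "(2 ^ n) powr (- s) = ((2::real) powr (- s)) ^ n"
        by (simp add: powr_powr powr_power mult.commute flip: powr_realpow)
      finally show ?thesis by simp
    qed
    moreover have "(2::real) powr (2 - s) = 4 * 2 powr (- s)"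
      by (simp add: powr_diff powr_minus_divide)
    moreover have "R powr (2 - s) = R powr (- s) * R\<^sup>2"
      using R by (simp add: powr_diff powr_minus_divide)
    moreover have "((2::real) ^ n)\<^sup>2 = 4 ^ n"
      by (simp add: power2_eq_square flip: power_mult_distrib)
    ultimately show "?c n * (?r n)\<^sup>2 = 4 * R powr (2 - s) * (2 powr (2 - s)) ^ n"
      by (simp add: power_mult_distrib)
  next
    show "(2::real) powr (2 - s) < 1"
      using s powr_less_mono[of "2 - s" 0 2] by simp
  qed (use R in auto)
  thus ?thesis by (simp add: mult.assoc mult.left_commute)
qed

text \<open>This integral governs the case \<open>p > 2\<close>. The power \<open>2 - 2 q\<close> is forced by scaling; finiteness
  needs \<open>q < 2\<close> at the two singularities and \<open>2 q > 2\<close> at infinity. With \<open>t = \<bar>z - w\<bar> / 2\<close>, the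
  point of \<open>z\<close>, \<open>w\<close> farther from \<open>x\<close> is at distance at least \<open>t\<close>, and also at least as far as the
  nearer one, so the integrand is controlled by a function of the distance to the nearer point alone:
  a power \<open>- q\<close> within distance \<open>t\<close> and a power \<open>- 2 q\<close> beyond.\<close>

lemma nn_integral_powr_pair:
  assumes q: "1 < q" "q < 2"
  obtains C where "0 \<le> C"
    "\<And>z w :: complex. z \<noteq> w \<Longrightarrow>
      (\<integral>\<^sup>+ x. ennreal ((cmod (z - x) * cmod (w - x)) powr (- q)) \<partial>lborel)
        \<le> ennreal (C * cmod (z - w) powr (2 - 2 * q))"
proof
  define A where "A = pi * 2 powr q / (1 - 2 powr (q - 2))"
  define B where "B = 4 * pi / (1 - 2 powr (2 - 2 * q))"
  have A: "0 \<le> A" and B: "0 \<le> B"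
    using q powr_less_mono[of "q - 2" 0 2] powr_less_mono[of "2 - 2 * q" 0 2]
    by (auto simp: A_def B_def intro!: divide_nonneg_nonneg)
  define C where "C = 2 * (A + B) * (1 / 2) powr (2 - 2 * q)"
  show "0 \<le> C"
    using A B by (simp add: C_def)
  fix z w :: complex
  assume "z \<noteq> w"
  define t where "t = cmod (z - w) / 2"
  have t: "0 < t"
    using \<open>z \<noteq> w\<close> by (simp add: t_def)
  define near where "near = (\<lambda>(a::complex) x. ennreal (t powr (- q)) *
    (ennreal (cmod (a - x) powr (- q)) * indicator (ball a t) x))"
  define far where "far = (\<lambda>(a::complex) x.
    ennreal (cmod (a - x) powr (- (2 * q))) * indicator (- ball a t) x)"
  have [measurable]: "ball a t \<in> sets borel" for a :: complex by simp
  have [measurable]: "near a \<in> borel_measurable borel" "far a \<in> borel_measurable borel" for a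
    unfolding near_def far_def by measurable
  have I: "(\<integral>\<^sup>+ x. near a x + far a x \<partial>lborel) \<le> ennreal ((A + B) * t powr (2 - 2 * q))" for a
  proof -
    have "(\<integral>\<^sup>+ x. near a x \<partial>lborel) = ennreal (t powr (- q)) *
        (\<integral>\<^sup>+ x. ennreal (cmod (a - x) powr (- q)) * indicator (ball a t) x \<partial>lborel)"
      unfolding near_def by (intro nn_integral_cmult) measurable
    also have "\<dots> \<le> ennreal (t powr (- q)) * ennreal (A * t powr (2 - q))"
      using nn_integral_powr_near[of q t a] q t by (intro mult_left_mono) (auto simp: A_def)
    also have "\<dots> = ennreal (A * t powr (2 - 2 * q))"
      using A by (auto simp: mult.left_commute simp flip: ennreal_mult powr_add)
    finally have "(\<integral>\<^sup>+ x. near a x \<partial>lborel) \<le> ennreal (A * t powr (2 - 2 * q))" .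
    moreover have "(\<integral>\<^sup>+ x. far a x \<partial>lborel) \<le> ennreal (B * t powr (2 - 2 * q))"
      using nn_integral_powr_far[of "2 * q" t a] q t by (auto simp: B_def far_def)
    moreover have "(\<integral>\<^sup>+ x. near a x + far a x \<partial>lborel)
        = (\<integral>\<^sup>+ x. near a x \<partial>lborel) + (\<integral>\<^sup>+ x. far a x \<partial>lborel)"
      by (intro nn_integral_add) measurable
    ultimately show ?thesis
      using A B by (auto simp: distrib_right intro!: add_mono)
  qed
  have half: "ennreal ((cmod (a - x) * cmod (b - x)) powr (- q)) \<le> near a x + far a x"
    if "cmod (a - x) \<le> cmod (b - x)" "cmod (a - b) = 2 * t" for a b x
  proof (cases "a = x")
    case False
    hence a0: "0 < cmod (a - x)" by simp
    have bt: "t \<le> cmod (b - x)"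
      using that norm_triangle_ineq4[of "a - x" "b - x"] by simp
    show ?thesis
    proof (cases "x \<in> ball a t")
      case True
      have "(cmod (a - x) * cmod (b - x)) powr (- q)
          = cmod (b - x) powr (- q) * cmod (a - x) powr (- q)"
        by (simp add: powr_mult)
      also have "\<dots> \<le> t powr (- q) * cmod (a - x) powr (- q)"
        using bt t q by (intro mult_right_mono powr_mono2') auto
      finally show ?thesis
        using True by (simp add: near_def far_def ennreal_leI flip: ennreal_mult)
    next
      case False
      have "(cmod (a - x) * cmod (b - x)) powr (- q)
          = cmod (b - x) powr (- q) * cmod (a - x) powr (- q)"
        by (simp add: powr_mult)
      also have "\<dots> \<le> cmod (a - x) powr (- q) * cmod (a - x) powr (- q)"
        using a0 that q by (intro mult_right_mono powr_mono2') auto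
      also have "\<dots> = cmod (a - x) powr (- (2 * q))"
        by (simp flip: powr_add)
      finally show ?thesis
        using False by (simp add: near_def far_def ennreal_leI)
    qed
  qed simp
  have "(\<integral>\<^sup>+ x. ennreal ((cmod (z - x) * cmod (w - x)) powr (- q)) \<partial>lborel)
      \<le> (\<integral>\<^sup>+ x. (near z x + far z x) + (near w x + far w x) \<partial>lborel)"
  proof (intro nn_integral_mono)
    fix x
    show "ennreal ((cmod (z - x) * cmod (w - x)) powr (- q))
        \<le> (near z x + far z x) + (near w x + far w x)"
    proof (cases "cmod (z - x) \<le> cmod (w - x)")
      case True
      from half[OF this] show ?thesis
        by (simp add: t_def add_increasing2)
    next
      case False
      with half[of w x z] show ?thesis
        by (simp add: t_def norm_minus_commute mult.commute add_increasing)
    qed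
  qed
  also have "\<dots> = (\<integral>\<^sup>+ x. near z x + far z x \<partial>lborel) + (\<integral>\<^sup>+ x. near w x + far w x \<partial>lborel)"
    by (intro nn_integral_add) measurable
  also have "\<dots> \<le> ennreal ((A + B) * t powr (2 - 2 * q)) + ennreal ((A + B) * t powr (2 - 2 * q))"
    by (intro add_mono I)
  also have "\<dots> = ennreal (C * cmod (z - w) powr (2 - 2 * q))"
    using A B by (simp add: C_def t_def powr_divide flip: ennreal_plus)
  finally show "(\<integral>\<^sup>+ x. ennreal ((cmod (z - x) * cmod (w - x)) powr (- q)) \<partial>lborel)
        \<le> ennreal (C * cmod (z - w) powr (2 - 2 * q))" .
qed

section \<open>Pairing a kernel with an \<open>L\<^sup>p\<close> function on the disk\<close>

text \<open>Reduces integrals over the disk of Borel functions to Lebesgue measure on Borel sets. The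
  normalising factor \<open>1 / \<pi>\<close> is at most \<open>1\<close> and is discarded.\<close>

lemma nn_integral_area_le:
  assumes [measurable]: "f \<in> borel_measurable borel"
  shows "(\<integral>\<^sup>+ x. f x \<partial>area_measure) \<le> (\<integral>\<^sup>+ x. f x * indicator unit_disk x \<partial>lborel)"
proof -
  have "(\<integral>\<^sup>+ x. f x \<partial>area_measure)
      = ennreal (1 / pi) * (\<integral>\<^sup>+ x. f x * indicator unit_disk x \<partial>lebesgue)"
    unfolding area_measure_def
    by (subst nn_integral_scale_measure)
      (auto intro!: measurable_restrict_space1 measurable_completion simp: nn_integral_restrict_space)
  also have "\<dots> = ennreal (1 / pi) * (\<integral>\<^sup>+ x. f x * indicator unit_disk x \<partial>lborel)"
    by (simp add: nn_integral_completion)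
  also have "\<dots> \<le> 1 * (\<integral>\<^sup>+ x. f x * indicator unit_disk x \<partial>lborel)"
    using pi_gt3 by (intro mult_right_mono) (auto simp: ennreal_le_1)
  finally show ?thesis by simp
qed

lemma borel_measurable_area:
  fixes f :: "complex \<Rightarrow> 'b :: topological_space"
  assumes "f \<in> borel_measurable borel"
  shows "f \<in> borel_measurable area_measure"
  using assms unfolding area_measure_def
  by (auto intro!: measurable_restrict_space1 measurable_completion
      simp: measurable_cong_sets[OF sets_scale_measure refl])

lemma space_area [simp]: "space area_measure = unit_disk"
  by (simp add: area_measure_def space_scale_measure)

lemma AE_area_neq: "AE x in area_measure. x \<noteq> z"
proof -
  have "(\<integral>\<^sup>+ x. indicator {z} x \<partial>area_measure) \<le> (\<integral>\<^sup>+ x. indicator {z} x * indicator unit_disk x \<partial>lborel)"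
    by (intro nn_integral_area_le) measurable
  also have "\<dots> \<le> (\<integral>\<^sup>+ x. indicator {z} x \<partial>lborel)"
    by (intro nn_integral_mono) (auto simp: indicator_def)
  also have "\<dots> = 0" by simp
  finally have "(\<integral>\<^sup>+ x. indicator {z} x \<partial>area_measure) = 0" by simp
  moreover have "(indicator {z} :: complex \<Rightarrow> ennreal) \<in> borel_measurable area_measure"
    by (intro borel_measurable_area) measurable
  ultimately have "AE x in area_measure. indicator {z} x = (0::ennreal)"
    by (subst (asm) nn_integral_0_iff_AE) auto
  thus ?thesis by eventually_elim (auto simp: indicator_def split: if_splits)
qed

lemma AE_area_disk_off:
  "AE x in area_measure. x \<in> unit_disk \<and> x \<noteq> z \<and> x \<noteq> w"
  using AE_space[of area_measure] AE_area_neq[of z] AE_area_neq[of w]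
  by eventually_elim simp

lemma nn_integral_powr_disk:
  assumes s: "0 \<le> s" "s < 2"
  obtains C where "0 \<le> C"
    "\<And>z. z \<in> unit_disk \<Longrightarrow> (\<integral>\<^sup>+ x. ennreal (cmod (z - x) powr (- s)) \<partial>area_measure) \<le> ennreal C"
proof
  define C where "C = pi * 2 powr s / (1 - 2 powr (s - 2)) * 2 powr (2 - s)"
  show "0 \<le> C"
    using s powr_less_mono[of "s - 2" 0 2] by (auto simp: C_def intro!: divide_nonneg_nonneg)
  fix z :: complex assume z: "z \<in> unit_disk"
  have "(\<integral>\<^sup>+ x. ennreal (cmod (z - x) powr (- s)) \<partial>area_measure)
      \<le> (\<integral>\<^sup>+ x. ennreal (cmod (z - x) powr (- s)) * indicator unit_disk x \<partial>lborel)"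
    by (intro nn_integral_area_le) measurable
  also have "\<dots> \<le> (\<integral>\<^sup>+ x. ennreal (cmod (z - x) powr (- s)) * indicator (ball z 2) x \<partial>lborel)"
  proof (intro nn_integral_mono mult_left_mono)
    fix x
    have "x \<in> ball z 2" if "x \<in> unit_disk"
      using that z norm_triangle_ineq4[of z x] by (simp add: dist_norm)
    thus "indicator unit_disk x \<le> (indicator (ball z 2) x :: ennreal)"
      by (auto simp: indicator_def)
  qed simp
  also have "\<dots> \<le> ennreal C"
    unfolding C_def using s by (intro nn_integral_powr_near) auto
  finally show "(\<integral>\<^sup>+ x. ennreal (cmod (z - x) powr (- s)) \<partial>area_measure) \<le> ennreal C" .
qed

text \<open>Young's inequality applied to \<open>(\<bar>K\<bar> / l) \<bar>g\<bar>\<close> plays the role of Hoelder's inequality: if the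
  \<open>L\<^sup>q\<close> norm of \<open>K\<close> is of order \<open>l\<close>, then so is the pairing of \<open>K\<close> with a fixed \<open>g\<close>. Keeping \<open>l\<close> as
  a parameter is what preserves the exact power of \<open>\<bar>z - w\<bar>\<close> later on.\<close>

lemma Lp_pairing_bound:
  assumes p: "1 < p" "1 < q" "1 / p + 1 / q = 1" and g: "g \<in> Lp_disk p"
    and K: "K \<in> borel_measurable area_measure"
    and l: "0 < l" and C: "0 \<le> C"
    and le: "(\<integral>\<^sup>+ x. ennreal (cmod (K x) powr q) \<partial>area_measure) \<le> ennreal (C * l powr q)"
  shows "integrable area_measure (\<lambda>x. K x * g x)"
    and "cmod (LINT x|area_measure. K x * g x)
      \<le> l * (C + enn2real (\<integral>\<^sup>+ x. ennreal (cmod (g x) powr p) \<partial>area_measure))"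
proof -
  let ?G = "\<integral>\<^sup>+ x. ennreal (cmod (g x) powr p) \<partial>area_measure"
  have gm: "g \<in> borel_measurable area_measure" and G: "?G < \<infinity>"
    using g by (auto simp: Lp_disk_def)
  note [measurable] = K gm
  have "(\<integral>\<^sup>+ x. ennreal (cmod (K x * g x)) \<partial>area_measure)
      \<le> (\<integral>\<^sup>+ x. ennreal (l powr (1 - q)) * ennreal (cmod (K x) powr q)
          + ennreal l * ennreal (cmod (g x) powr p) \<partial>area_measure)"
  proof (intro nn_integral_mono)
    fix x
    have "cmod (K x) / l * cmod (g x) \<le> (cmod (K x) / l) powr q / q + cmod (g x) powr p / p"
      using p l by (intro Youngs_inequality) auto
    also have "\<dots> \<le> (cmod (K x) / l) powr q + cmod (g x) powr p"
      using p by (intro add_mono) (auto simp: divide_le_eq mult_le_cancel_left1)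
    finally have "l * (cmod (K x) / l * cmod (g x)) \<le> l * ((cmod (K x) / l) powr q + cmod (g x) powr p)"
      using l by (intro mult_left_mono) auto
    also have "\<dots> = l powr (1 - q) * cmod (K x) powr q + l * cmod (g x) powr p"
      using l by (simp add: powr_divide powr_diff algebra_simps)
    finally have "cmod (K x * g x) \<le> l powr (1 - q) * cmod (K x) powr q + l * cmod (g x) powr p"
      using l by (simp add: norm_mult)
    thus "ennreal (cmod (K x * g x)) \<le> ennreal (l powr (1 - q)) * ennreal (cmod (K x) powr q)
          + ennreal l * ennreal (cmod (g x) powr p)"
      using l by (auto simp flip: ennreal_mult ennreal_plus intro!: ennreal_leI)
  qed
  also have "\<dots> = (\<integral>\<^sup>+ x. ennreal (l powr (1 - q)) * ennreal (cmod (K x) powr q) \<partial>area_measure)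
      + (\<integral>\<^sup>+ x. ennreal l * ennreal (cmod (g x) powr p) \<partial>area_measure)"
    by (intro nn_integral_add) measurable
  also have "\<dots> = ennreal (l powr (1 - q)) * (\<integral>\<^sup>+ x. ennreal (cmod (K x) powr q) \<partial>area_measure)
      + ennreal l * ?G"
    by (intro arg_cong2[where f = "(+)"] nn_integral_cmult) measurable
  also have "\<dots> \<le> ennreal (l powr (1 - q)) * ennreal (C * l powr q) + ennreal l * ennreal (enn2real ?G)"
    using G le by (intro add_mono mult_left_mono) (auto simp: less_top)
  also have "\<dots> = ennreal (l * C + l * enn2real ?G)"
    using l C by (simp add: powr_diff flip: ennreal_mult ennreal_plus)
  finally have bd: "(\<integral>\<^sup>+ x. ennreal (cmod (K x * g x)) \<partial>area_measure)
      \<le> ennreal (l * (C + enn2real ?G))"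
    by (simp add: distrib_left)
  show int: "integrable area_measure (\<lambda>x. K x * g x)"
    using bd by (intro integrableI_bounded) (auto simp: le_less_trans)
  have "ennreal (cmod (LINT x|area_measure. K x * g x)) \<le> ennreal (l * (C + enn2real ?G))"
    using integral_norm_bound_ennreal[OF int] bd by simp
  thus "cmod (LINT x|area_measure. K x * g x) \<le> l * (C + enn2real ?G)"
    using l C by (subst (asm) ennreal_le_iff) auto
qed

text \<open>The condition on \<open>\<epsilon>\<close> says that \<open>\<bar>z - x\<bar>\<^bsup>- \<epsilon>\<^esup>\<close> lies in \<open>L\<^sup>q\<close> for the conjugate exponent
  \<open>q = p / (p - 1)\<close>, uniformly in \<open>z\<close>. The second point \<open>w\<close> serves differences of kernels.\<close>

lemma Lp_pairing_bound_two_points: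
  assumes p: "1 < p" "g \<in> Lp_disk p" and e: "0 \<le> \<epsilon>" "\<epsilon> * (p / (p - 1)) < 2"
  obtains D where
    "\<And>z w K c. z \<in> unit_disk \<Longrightarrow> w \<in> unit_disk \<Longrightarrow> K \<in> borel_measurable area_measure \<Longrightarrow> 0 < c \<Longrightarrow>
      AE x in area_measure. cmod (K x) \<le> c * (cmod (z - x) powr (- \<epsilon>) + cmod (w - x) powr (- \<epsilon>)) \<Longrightarrow>
      integrable area_measure (\<lambda>x. K x * g x) \<and> cmod (LINT x|area_measure. K x * g x) \<le> D * c"
proof -
  define q where "q = p / (p - 1)"
  have q: "1 < q" "1 / p + 1 / q = 1" "0 \<le> \<epsilon> * q" "\<epsilon> * q < 2"
    using p e by (auto simp: q_def field_simps)
  obtain C where C: "0 \<le> C"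
    "\<And>z. z \<in> unit_disk \<Longrightarrow>
      (\<integral>\<^sup>+ x. ennreal (cmod (z - x) powr (- (\<epsilon> * q))) \<partial>area_measure) \<le> ennreal C"
    using nn_integral_powr_disk[OF q(3,4)] by blast
  define C' where "C' = 2 powr q * (2 * C)"
  have C': "0 \<le> C'"
    using C by (simp add: C'_def)
  define D where "D = C' + enn2real (\<integral>\<^sup>+ x. ennreal (cmod (g x) powr p) \<partial>area_measure)"
  show ?thesis
  proof (rule that)
    fix z w K c
    assume zw: "z \<in> unit_disk" "w \<in> unit_disk" and K: "K \<in> borel_measurable area_measure" and c: "0 < c"
      and le: "AE x in area_measure. cmod (K x) \<le> c * (cmod (z - x) powr (- \<epsilon>) + cmod (w - x) powr (- \<epsilon>))"
    let ?h = "\<lambda>a x. ennreal (cmod (a - x) powr (- (\<epsilon> * q)))"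
    have [measurable]: "?h a \<in> borel_measurable area_measure" for a
      by (rule borel_measurable_area) measurable
    have "(\<integral>\<^sup>+ x. ennreal (cmod (K x) powr q) \<partial>area_measure)
        \<le> (\<integral>\<^sup>+ x. ennreal ((2 * c) powr q) * (?h z x + ?h w x) \<partial>area_measure)"
    proof (rule nn_integral_mono_AE, use le in eventually_elim)
      fix x
      assume x: "cmod (K x) \<le> c * (cmod (z - x) powr (- \<epsilon>) + cmod (w - x) powr (- \<epsilon>))"
      define u where "u = cmod (z - x) powr (- \<epsilon>)"
      define v where "v = cmod (w - x) powr (- \<epsilon>)"
      have uv: "0 \<le> u" "0 \<le> v" by (auto simp: u_def v_def)
      have "cmod (K x) powr q \<le> (2 * c * max u v) powr q"
      proof (rule powr_mono2)
        have "c * (u + v) \<le> c * (2 * max u v)"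
          using c by (intro mult_left_mono) auto
        thus "cmod (K x) \<le> 2 * c * max u v"
          using x by (simp add: u_def v_def)
      qed (use q in auto)
      also have "\<dots> = (2 * c) powr q * max u v powr q"
        using c uv by (intro powr_mult) 
      also have "\<dots> \<le> (2 * c) powr q * (u powr q + v powr q)"
        by (intro mult_left_mono) (auto simp: max_def)
      also have "u powr q = cmod (z - x) powr (- (\<epsilon> * q))"
        by (simp add: u_def powr_powr)
      also have "v powr q = cmod (w - x) powr (- (\<epsilon> * q))"
        by (simp add: v_def powr_powr)
      finally show "ennreal (cmod (K x) powr q) \<le> ennreal ((2 * c) powr q) * (?h z x + ?h w x)"
        by (auto simp flip: ennreal_mult ennreal_plus intro!: ennreal_leI)
    qed
    also have "\<dots> = ennreal ((2 * c) powr q) *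
        ((\<integral>\<^sup>+ x. ?h z x \<partial>area_measure) + (\<integral>\<^sup>+ x. ?h w x \<partial>area_measure))"
      by (subst nn_integral_cmult, measurable, subst nn_integral_add) measurable
    also have "\<dots> \<le> ennreal ((2 * c) powr q) * (ennreal C + ennreal C)"
      by (intro mult_left_mono add_mono C zw) simp
    also have "\<dots> = ennreal (C' * c powr q)"
      using C(1) c by (simp add: C'_def powr_mult ac_simps flip: ennreal_mult ennreal_plus)
    finally have *: "(\<integral>\<^sup>+ x. ennreal (cmod (K x) powr q) \<partial>area_measure) \<le> ennreal (C' * c powr q)" .
    show "integrable area_measure (\<lambda>x. K x * g x) \<and> cmod (LINT x|area_measure. K x * g x) \<le> D * c"
      using Lp_pairing_bound[OF p(1) q(1,2) p(2) K c C' *] by (simp add: D_def mult.commute)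
  qed
qed

text \<open>Here \<open>q < 2\<close> because \<open>p > 2\<close>, and the exponent is \<open>(2 - 2 q) / q = - 2 / p\<close>.\<close>

lemma Lp_pairing_bound_pair:
  assumes p: "2 < p" "g \<in> Lp_disk p"
  obtains D where
    "\<And>z w K c. z \<noteq> w \<Longrightarrow> K \<in> borel_measurable area_measure \<Longrightarrow> 0 < c \<Longrightarrow>
      AE x in area_measure. cmod (K x) \<le> c / (cmod (z - x) * cmod (w - x)) \<Longrightarrow>
      integrable area_measure (\<lambda>x. K x * g x) \<and>
      cmod (LINT x|area_measure. K x * g x) \<le> D * (c * cmod (z - w) powr (- 2 / p))"
proof -
  define q where "q = p / (p - 1)"
  have q: "1 < q" "q < 2" "1 / p + 1 / q = 1" "(- 2 / p) * q = 2 - 2 * q"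
    using p by (auto simp: q_def field_simps)
  obtain C where C: "0 \<le> C"
    "\<And>z w :: complex. z \<noteq> w \<Longrightarrow>
      (\<integral>\<^sup>+ x. ennreal ((cmod (z - x) * cmod (w - x)) powr (- q)) \<partial>lborel)
        \<le> ennreal (C * cmod (z - w) powr (2 - 2 * q))"
    using nn_integral_powr_pair[OF q(1,2)] by blast
  define D where "D = C + enn2real (\<integral>\<^sup>+ x. ennreal (cmod (g x) powr p) \<partial>area_measure)"
  show ?thesis
  proof (rule that)
    fix z w K c
    assume zw: "z \<noteq> w" and K: "K \<in> borel_measurable area_measure" and c: "0 < c"
      and le: "AE x in area_measure. cmod (K x) \<le> c / (cmod (z - x) * cmod (w - x))"
    define l where "l = c * cmod (z - w) powr (- 2 / p)"
    have l: "0 < l"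
      using zw c by (simp add: l_def)
    let ?h = "\<lambda>x. ennreal ((cmod (z - x) * cmod (w - x)) powr (- q))"
    have [measurable]: "?h \<in> borel_measurable area_measure"
      by (rule borel_measurable_area) measurable
    have "(\<integral>\<^sup>+ x. ennreal (cmod (K x) powr q) \<partial>area_measure)
        \<le> (\<integral>\<^sup>+ x. ennreal (c powr q) * ?h x \<partial>area_measure)"
    proof (rule nn_integral_mono_AE, use le in eventually_elim)
      fix x
      assume "cmod (K x) \<le> c / (cmod (z - x) * cmod (w - x))"
      hence "cmod (K x) powr q \<le> (c / (cmod (z - x) * cmod (w - x))) powr q"
        using q by (intro powr_mono2) auto
      also have "\<dots> = c powr q * (cmod (z - x) * cmod (w - x)) powr (- q)"
        using c by (simp add: powr_divide powr_minus_divide)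
      finally show "ennreal (cmod (K x) powr q) \<le> ennreal (c powr q) * ?h x"
        by (auto simp flip: ennreal_mult intro!: ennreal_leI)
    qed
    also have "\<dots> = ennreal (c powr q) * (\<integral>\<^sup>+ x. ?h x \<partial>area_measure)"
      by (intro nn_integral_cmult) measurable
    also have "(\<integral>\<^sup>+ x. ?h x \<partial>area_measure) \<le> (\<integral>\<^sup>+ x. ?h x * indicator unit_disk x \<partial>lborel)"
      by (intro nn_integral_area_le) measurable
    also have "\<dots> \<le> (\<integral>\<^sup>+ x. ?h x \<partial>lborel)"
      by (intro nn_integral_mono) (auto simp: indicator_def)
    also have "\<dots> \<le> ennreal (C * cmod (z - w) powr (2 - 2 * q))"
      by (rule C(2)[OF zw])
    also have "ennreal (c powr q) * \<dots> = ennreal (C * l powr q)"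
    proof -
      have "l powr q = c powr q * cmod (z - w) powr ((- 2 / p) * q)"
        using c unfolding l_def by (subst powr_mult) (simp_all add: powr_powr)
      thus ?thesis
        unfolding q(4) using C(1) by (simp add: mult.left_commute flip: ennreal_mult)
    qed
    finally have *: "(\<integral>\<^sup>+ x. ennreal (cmod (K x) powr q) \<partial>area_measure) \<le> ennreal (C * l powr q)"
      by (simp add: mult_left_mono)
    have p1: "1 < p" using p by simp
    show "integrable area_measure (\<lambda>x. K x * g x) \<and>
      cmod (LINT x|area_measure. K x * g x) \<le> D * (c * cmod (z - w) powr (- 2 / p))"
      using Lp_pairing_bound[OF p1 q(1,3) p(2) K l C(1) *]
      unfolding D_def l_def[symmetric] by (simp add: mult.commute)
  qed
qed

section \<open>The reflected factor\<close>

text \<open>The pseudo-hyperbolic distance is at most one, by the identity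
  \<open>\<bar>1 - z x\<^sup>*\<bar>\<^sup>2 - \<bar>z - x\<bar>\<^sup>2 = (1 - \<bar>z\<bar>\<^sup>2) (1 - \<bar>x\<bar>\<^sup>2)\<close>, where \<open>x\<^sup>*\<close> is the conjugate. It makes every
  estimate for the singular factor of the Green kernel hold for the regular factor as well.\<close>

lemma cmod_diff_le_reflected:
  assumes "z \<in> unit_disk" "x \<in> unit_disk"
  shows "cmod (z - x) \<le> cmod (1 - z * cnj x)"
proof (rule power2_le_imp_le)
  have "(cmod z)\<^sup>2 \<le> 1" "(cmod x)\<^sup>2 \<le> 1"
    using assms by (auto simp: abs_square_le_1)
  hence "0 \<le> (1 - (cmod z)\<^sup>2) * (1 - (cmod x)\<^sup>2)" by simp
  also have "\<dots> = (cmod (1 - z * cnj x))\<^sup>2 - (cmod (z - x))\<^sup>2"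
    unfolding cmod_power2 by (simp add: power2_eq_square algebra_simps)
  finally show "(cmod (z - x))\<^sup>2 \<le> (cmod (1 - z * cnj x))\<^sup>2" by simp
qed simp

lemma reflected_neq_0:
  assumes "z \<in> unit_disk" "x \<in> unit_disk"
  shows "1 - z * cnj x \<noteq> 0"
proof
  assume "1 - z * cnj x = 0"
  hence "cmod z * cmod x = 1"
    by (metis complex_mod_cnj eq_iff_diff_eq_0 norm_mult norm_one)
  moreover have "cmod z * cmod x < 1 * 1"
    using assms by (intro mult_strict_mono') auto
  ultimately show False by simp
qed

section \<open>Increments of the logarithm of the modulus\<close>

lemma ln_one_plus_le_powr:
  fixes y :: real
  assumes "0 \<le> y" "0 < \<epsilon>" "\<epsilon> \<le> 1"
  shows "ln (1 + y) \<le> 2 / \<epsilon> * y powr \<epsilon>"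
proof (cases "y \<le> 1")
  case True
  have "ln (1 + y) \<le> y"
    using assms by (intro ln_add_one_self_le_self)
  also have "y = y powr 1" using assms by simp
  also have "\<dots> \<le> y powr \<epsilon>"
    using assms True by (intro powr_mono') auto
  also have "\<dots> = 1 * y powr \<epsilon>" by simp
  also have "\<dots> \<le> 2 / \<epsilon> * y powr \<epsilon>"
    using assms by (intro mult_right_mono) auto
  finally show ?thesis .
next
  case False
  have "ln (1 + y) \<le> ln (2 * y)"
    using False by (subst ln_le_cancel_iff) auto
  also have "\<dots> \<le> (2 * y) powr \<epsilon> / \<epsilon>"
    using False assms by (intro ln_powr_bound) auto
  also have "\<dots> = 2 powr \<epsilon> * y powr \<epsilon> / \<epsilon>"
    using assms by (simp add: powr_mult)
  also have "\<dots> \<le> 2 powr 1 * y powr \<epsilon> / \<epsilon>"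
    using assms by (intro divide_right_mono mult_right_mono powr_mono) auto
  finally show ?thesis by simp
qed

text \<open>If \<open>\<bar>a\<bar> \<ge> \<bar>b\<bar>\<close>, then \<open>\<bar>a\<bar> / \<bar>b\<bar> \<le> 1 + \<bar>a - b\<bar> / \<bar>b\<bar>\<close>, and the logarithm of the right-hand side grows
  more slowly than any power; both singular terms appear because either modulus may be the smaller.\<close>

lemma ln_cmod_diff_le_powr:
  fixes a b :: complex
  assumes "a \<noteq> 0" "b \<noteq> 0" "0 < \<epsilon>" "\<epsilon> \<le> 1"
  shows "\<bar>ln ((cmod a)\<^sup>2) - ln ((cmod b)\<^sup>2)\<bar>
    \<le> 4 / \<epsilon> * cmod (a - b) powr \<epsilon> * (cmod a powr (- \<epsilon>) + cmod b powr (- \<epsilon>))"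
proof -
  have one_sided: "ln (cmod a) - ln (cmod b)
      \<le> 2 / \<epsilon> * cmod (a - b) powr \<epsilon> * (cmod a powr (- \<epsilon>) + cmod b powr (- \<epsilon>))"
    if "a \<noteq> 0" "b \<noteq> 0" for a b :: complex
  proof -
    have "cmod a \<le> cmod (a - b) + cmod b"
      using norm_triangle_ineq[of "a - b" b] by simp
    hence "ln (cmod a / cmod b) \<le> ln (1 + cmod (a - b) / cmod b)"
      using that by (subst ln_le_cancel_iff) (auto simp: field_simps add_pos_nonneg)
    also have "\<dots> \<le> 2 / \<epsilon> * (cmod (a - b) / cmod b) powr \<epsilon>"
      using assms by (intro ln_one_plus_le_powr) auto
    also have "\<dots> = 2 / \<epsilon> * cmod (a - b) powr \<epsilon> * cmod b powr (- \<epsilon>)"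
      by (simp add: powr_divide powr_minus_divide)
    also have "\<dots> \<le> 2 / \<epsilon> * cmod (a - b) powr \<epsilon> * (cmod a powr (- \<epsilon>) + cmod b powr (- \<epsilon>))"
      using assms by (intro mult_left_mono) auto
    finally show ?thesis using that by (simp add: ln_div)
  qed
  show ?thesis
    using one_sided[OF assms(1,2)] one_sided[OF assms(2,1)] assms(1,2)
    by (simp add: ln_realpow norm_minus_commute add.commute abs_le_iff)
qed

text \<open>The second-order remainder of the logarithm, in a form that is integrable to a power \<open>q < 2\<close> at
  both singularities: \<open>\<bar>b\<bar>\<^sup>2\<close> in the usual denominator is replaced by \<open>\<bar>a\<bar> \<bar>b\<bar>\<close>. With \<open>x = a / b\<close>, \<open>r = \<bar>x\<bar>\<close>
  and \<open>d = \<bar>x - 1\<bar>\<close> the claim is \<open>\<bar>E\<bar> \<le> 4 d\<^sup>2 / r\<close> for \<open>E = 2 ln r - 2 Re (x - 1)\<close>. From below it follows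
  from \<open>E = d\<^sup>2 - (r - 1)\<^sup>2 + 2 (ln r - r + 1)\<close>, \<open>ln r \<ge> 1 - 1 / r\<close> and \<open>\<bar>r - 1\<bar> \<le> d\<close>; from above, from \<open>ln r \<le> r - 1\<close> and
  \<open>2 (r - Re x) = \<bar>r - x\<bar>\<^sup>2 / r \<le> (2 d)\<^sup>2 / r\<close>.\<close>

lemma ln_cmod_taylor:
  fixes a b :: complex
  assumes "a \<noteq> 0" "b \<noteq> 0"
  shows "\<bar>ln ((cmod a)\<^sup>2) - ln ((cmod b)\<^sup>2) - 2 * Re ((a - b) / b)\<bar>
    \<le> 4 * (cmod (a - b))\<^sup>2 / (cmod a * cmod b)"
proof -
  define x where "x = a / b"
  define r where "r = cmod x"
  define d where "d = cmod (x - 1)"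
  have r: "0 < r" using assms by (simp add: r_def x_def)
  have xb: "(a - b) / b = x - 1"
    using assms by (simp add: x_def field_simps)
  define E where "E = 2 * ln r - 2 * Re (x - 1)"
  have E_eq: "E = d\<^sup>2 - (r - 1)\<^sup>2 + 2 * (ln r - r + 1)"
    unfolding E_def d_def r_def cmod_power2 power2_diff by (simp add: power2_eq_square algebra_simps)
  have rd: "\<bar>r - 1\<bar> \<le> d"
    using norm_triangle_ineq3[of x 1] by (simp add: r_def d_def)
  hence rd2: "(r - 1)\<^sup>2 \<le> d\<^sup>2"
    by (metis abs_le_square_iff abs_of_nonneg d_def norm_ge_zero)
  have "ln (1 / r) \<le> 1 / r - 1"
    using r by (intro ln_le_minus_one) auto
  hence "- ((r - 1)\<^sup>2 / r) \<le> ln r - r + 1"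
    using r by (simp add: ln_div power2_eq_square field_simps)
  moreover have "(r - 1)\<^sup>2 / r \<le> d\<^sup>2 / r"
    using rd2 r by (intro divide_right_mono) auto
  ultimately have "- (d\<^sup>2 / r) \<le> ln r - r + 1"
    by (meson le_imp_neg_le order_trans)
  hence "- (2 * (d\<^sup>2 / r)) \<le> E"
    unfolding E_eq using rd2 by simp
  moreover have "0 \<le> d\<^sup>2 / r" using r by simp
  ultimately have lower: "- (4 * (d\<^sup>2 / r)) \<le> E"
    by linarith
  have "E \<le> 2 * (r - Re x)"
  proof -
    have "ln r \<le> r - 1" using r by (rule ln_le_minus_one)
    thus ?thesis by (simp add: E_def)
  qed
  also have "\<dots> = (cmod (of_real r - x))\<^sup>2 / r"
  proof -
    have "(cmod (of_real r - x))\<^sup>2 = r\<^sup>2 - 2 * r * Re x + r\<^sup>2"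
      unfolding r_def cmod_power2 by (simp add: power2_eq_square algebra_simps cmod_def)
    thus ?thesis using r by (simp add: power2_eq_square field_simps)
  qed
  also have "\<dots> \<le> (2 * d)\<^sup>2 / r"
  proof -
    have "cmod (of_real r - x) \<le> cmod (of_real r - 1) + cmod (1 - x)"
      using norm_triangle_ineq[of "of_real r - 1" "1 - x"] by simp
    also have "\<dots> = \<bar>r - 1\<bar> + d"
      by (metis d_def norm_minus_commute norm_of_real of_real_1 of_real_diff)
    finally have "cmod (of_real r - x) \<le> 2 * d" using rd by simp
    thus ?thesis using r by (intro divide_right_mono power_mono) auto
  qed
  finally have upper: "E \<le> 4 * (d\<^sup>2 / r)" by (simp add: power2_eq_square)
  have "E = ln ((cmod a)\<^sup>2) - ln ((cmod b)\<^sup>2) - 2 * Re ((a - b) / b)"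
    using assms by (simp add: E_def r_def xb x_def norm_divide ln_div ln_realpow algebra_simps)
  moreover have "d\<^sup>2 / r = (cmod (a - b))\<^sup>2 / (cmod a * cmod b)"
    using assms unfolding d_def r_def xb[symmetric]
    by (simp add: x_def norm_divide power2_eq_square)
  ultimately show ?thesis
    using lower upper by (simp add: abs_le_iff)
qed

section \<open>The Green kernel and its Wirtinger derivative\<close>

definition green_kernel :: "complex \<Rightarrow> complex \<Rightarrow> complex" where
  "green_kernel z x = complex_of_real (ln ((cmod ((z - x) / (1 - cnj z * x)))\<^sup>2))"

text \<open>Writing the modulus squared of the quotient in the Green kernel as a product with its conjugate,
  only \<open>z - x\<close> and \<open>1 - z x\<^sup>*\<close> depend holomorphically on \<open>z\<close>; this is the resulting derivative
  \<open>\<partial> / \<partial>z\<close>. The real derivative in the direction \<open>h\<close> is twice the real part of \<open>h\<close> times it.\<close>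

definition green_kernel_dz :: "complex \<Rightarrow> complex \<Rightarrow> complex" where
  "green_kernel_dz z x = 1 / (z - x) + cnj x / (1 - z * cnj x)"

lemma borel_measurable_green_kernel:
  "green_kernel z \<in> borel_measurable area_measure"
  "green_kernel_dz z \<in> borel_measurable area_measure"
proof -
  have "green_kernel z \<in> borel_measurable borel"
    unfolding green_kernel_def by measurable
  thus "green_kernel z \<in> borel_measurable area_measure" by (rule borel_measurable_area)
  have [measurable]: "cnj \<in> borel_measurable borel"
    by (intro borel_measurable_continuous_onI continuous_intros)
  have "green_kernel_dz z \<in> borel_measurable borel"
    unfolding green_kernel_dz_def by measurable
  thus "green_kernel_dz z \<in> borel_measurable area_measure" by (rule borel_measurable_area)
qed

text \<open>Conjugating the denominator, which keeps its modulus, turns the kernel into a difference of two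
  functions \<open>ln \<bar>f\<bar>\<^sup>2\<close> with \<open>f\<close> affine in \<open>z\<close> and of slope at most one.\<close>

lemma green_kernel_split:
  assumes "z \<in> unit_disk" "x \<in> unit_disk" "x \<noteq> z"
  shows "green_kernel z x = complex_of_real (ln ((cmod (z - x))\<^sup>2) - ln ((cmod (1 - z * cnj x))\<^sup>2))"
proof -
  have "cmod (1 - cnj z * x) = cmod (1 - z * cnj x)"
    by (metis complex_cnj_cnj complex_cnj_diff complex_cnj_mult complex_cnj_one complex_mod_cnj)
  thus ?thesis
    using assms reflected_neq_0[OF assms(1,2)]
    by (simp add: green_kernel_def norm_divide power_divide ln_div)
qed

text \<open>The kernel is \<open>- 2\<close> times the logarithm of a quotient between \<open>1\<close> and \<open>2 / \<bar>z - x\<bar>\<close>.\<close>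

lemma cmod_green_kernel_le:
  assumes "z \<in> unit_disk" "x \<in> unit_disk" "x \<noteq> z" "0 < \<epsilon>"
  shows "cmod (green_kernel z x) \<le> 2 * 2 powr \<epsilon> / \<epsilon> * cmod (z - x) powr (- \<epsilon>)"
proof -
  let ?a = "cmod (z - x)" and ?b = "cmod (1 - z * cnj x)"
  have a: "0 < ?a" and ab: "?a \<le> ?b"
    using assms cmod_diff_le_reflected by auto
  have "cmod z * cmod x \<le> 1 * 1"
    using assms by (intro mult_mono) auto
  hence "?b \<le> 2"
    using norm_triangle_ineq4[of 1 "z * cnj x"] by (simp add: norm_mult)
  have "ln (?b / ?a) \<le> (?b / ?a) powr \<epsilon> / \<epsilon>"
    using a ab assms by (intro ln_powr_bound) auto
  also have "\<dots> \<le> (2 / ?a) powr \<epsilon> / \<epsilon>"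
    using a \<open>?b \<le> 2\<close> assms by (intro divide_right_mono powr_mono2) (auto simp: divide_right_mono)
  also have "\<dots> = 2 powr \<epsilon> / \<epsilon> * ?a powr (- \<epsilon>)"
    by (simp add: powr_divide powr_minus_divide)
  finally have *: "ln (?b / ?a) \<le> 2 powr \<epsilon> / \<epsilon> * ?a powr (- \<epsilon>)" .
  have "ln (?a\<^sup>2) - ln (?b\<^sup>2) = - (2 * ln (?b / ?a))"
    using a ab by (subst ln_div) (auto simp: ln_realpow simp del: norm_eq_zero zero_less_norm_iff norm_le_zero_iff)
  hence "green_kernel z x = complex_of_real (- (2 * ln (?b / ?a)))"
    using assms by (simp only: green_kernel_split not_False_eq_True)
  hence "cmod (green_kernel z x) = 2 * ln (?b / ?a)"
    using a ab by (simp only: norm_of_real) (simp add: abs_mult)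
  with * show ?thesis by simp
qed

text \<open>Both logarithms in the splitting of the kernel obey the same bound: the reflected
  factors differ by \<open>\<bar>z - w\<bar> \<bar>x\<bar> \<le> \<bar>z - w\<bar>\<close> and have larger modulus.\<close>

lemma cmod_green_kernel_diff_le:
  assumes zw: "z \<in> unit_disk" "w \<in> unit_disk" and x: "x \<in> unit_disk" "x \<noteq> z" "x \<noteq> w"
    and e: "0 < \<epsilon>" "\<epsilon> \<le> 1"
  shows "cmod (green_kernel z x - green_kernel w x)
    \<le> 8 / \<epsilon> * cmod (z - w) powr \<epsilon> * (cmod (z - x) powr (- \<epsilon>) + cmod (w - x) powr (- \<epsilon>))"
proof -
  let ?a = "1 - z * cnj x" and ?b = "1 - w * cnj x"
  let ?S = "4 / \<epsilon> * cmod (z - w) powr \<epsilon> * (cmod (z - x) powr (- \<epsilon>) + cmod (w - x) powr (- \<epsilon>))"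
  have "\<bar>ln ((cmod (z - x))\<^sup>2) - ln ((cmod (w - x))\<^sup>2)\<bar> \<le> ?S"
    using ln_cmod_diff_le_powr[of "z - x" "w - x" \<epsilon>] x e by simp
  moreover have "\<bar>ln ((cmod ?a)\<^sup>2) - ln ((cmod ?b)\<^sup>2)\<bar> \<le> ?S"
  proof -
    have "\<bar>ln ((cmod ?a)\<^sup>2) - ln ((cmod ?b)\<^sup>2)\<bar>
        \<le> 4 / \<epsilon> * cmod (?a - ?b) powr \<epsilon> * (cmod ?a powr (- \<epsilon>) + cmod ?b powr (- \<epsilon>))"
      using zw x e by (intro ln_cmod_diff_le_powr reflected_neq_0)
    also have "\<dots> \<le> ?S"
    proof (intro mult_mono add_mono)
      have "?a - ?b = - ((z - w) * cnj x)"
        by (simp add: algebra_simps)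
      hence "cmod (?a - ?b) = cmod (z - w) * cmod x"
        by (simp only: norm_minus_cancel norm_mult complex_mod_cnj)
      hence "cmod (?a - ?b) \<le> cmod (z - w)"
        using x by (simp add: mult_left_le)
      thus "cmod (?a - ?b) powr \<epsilon> \<le> cmod (z - w) powr \<epsilon>"
        using e by (intro powr_mono2) auto
      show "cmod ?a powr (- \<epsilon>) \<le> cmod (z - x) powr (- \<epsilon>)"
        using cmod_diff_le_reflected[OF zw(1) x(1)] x e by (intro powr_mono2') auto
      show "cmod ?b powr (- \<epsilon>) \<le> cmod (w - x) powr (- \<epsilon>)"
        using cmod_diff_le_reflected[OF zw(2) x(1)] x e by (intro powr_mono2') auto
    qed (use e in auto)
    finally show ?thesis .
  qed
  moreover have "green_kernel z x - green_kernel w x = complex_of_real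
      ((ln ((cmod (z - x))\<^sup>2) - ln ((cmod (w - x))\<^sup>2)) - (ln ((cmod ?a)\<^sup>2) - ln ((cmod ?b)\<^sup>2)))"
    using zw x by (simp add: green_kernel_split)
  ultimately have "cmod (green_kernel z x - green_kernel w x) \<le> ?S + ?S"
    by (simp only: norm_of_real)
  also have "?S + ?S = 8 / \<epsilon> * cmod (z - w) powr \<epsilon> * (cmod (z - x) powr (- \<epsilon>) + cmod (w - x) powr (- \<epsilon>))"
    by (simp add: field_simps)
  finally show ?thesis .
qed

text \<open>The remainder of each of the two logarithms is bounded by the same quantity, again because the
  reflected factors are closer together and larger.\<close>

lemma green_kernel_taylor:
  assumes zw: "z \<in> unit_disk" "w \<in> unit_disk" and x: "x \<in> unit_disk" "x \<noteq> z" "x \<noteq> w"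
  shows "cmod (green_kernel w x - green_kernel z x
      - complex_of_real (2 * Re ((w - z) * green_kernel_dz z x)))
    \<le> 8 * (cmod (z - w))\<^sup>2 / (cmod (z - x) * cmod (w - x))"
proof -
  let ?a = "1 - w * cnj x" and ?b = "1 - z * cnj x"
  let ?S = "4 * (cmod (z - w))\<^sup>2 / (cmod (z - x) * cmod (w - x))"
  have nz: "?a \<noteq> 0" "?b \<noteq> 0"
    by (rule reflected_neq_0[OF zw(2) x(1)], rule reflected_neq_0[OF zw(1) x(1)])
  have ab: "?a - ?b = - ((w - z) * cnj x)"
    by (simp add: algebra_simps)
  have 1: "\<bar>ln ((cmod (w - x))\<^sup>2) - ln ((cmod (z - x))\<^sup>2) - 2 * Re ((w - z) / (z - x))\<bar> \<le> ?S"
    using ln_cmod_taylor[of "w - x" "z - x"] x by (simp add: norm_minus_commute[of w z] mult.commute)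
  have 2: "\<bar>ln ((cmod ?a)\<^sup>2) - ln ((cmod ?b)\<^sup>2) - 2 * Re ((?a - ?b) / ?b)\<bar> \<le> ?S"
  proof -
    have "\<bar>ln ((cmod ?a)\<^sup>2) - ln ((cmod ?b)\<^sup>2) - 2 * Re ((?a - ?b) / ?b)\<bar>
        \<le> 4 * (cmod (?a - ?b))\<^sup>2 / (cmod ?a * cmod ?b)"
      by (intro ln_cmod_taylor nz)
    also have "\<dots> \<le> 4 * (cmod (z - w))\<^sup>2 / (cmod (w - x) * cmod (z - x))"
    proof (intro frac_le mult_mono mult_left_mono power_mono)
      have "cmod (?a - ?b) = cmod (z - w) * cmod x"
        unfolding ab by (simp add: norm_mult norm_minus_commute)
      thus "cmod (?a - ?b) \<le> cmod (z - w)"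
        using x by (simp add: mult_left_le)
    qed (use zw x cmod_diff_le_reflected in auto)
    finally show ?thesis by (simp add: mult.commute)
  qed
  have "(w - z) * green_kernel_dz z x = (w - z) / (z - x) - (?a - ?b) / ?b"
    unfolding ab by (simp add: green_kernel_dz_def distrib_left)
  hence Re_eq: "Re ((w - z) * green_kernel_dz z x) = Re ((w - z) / (z - x)) - Re ((?a - ?b) / ?b)"
    by simp
  have "green_kernel w x - green_kernel z x
      - complex_of_real (2 * Re ((w - z) * green_kernel_dz z x)) = complex_of_real
      ((ln ((cmod (w - x))\<^sup>2) - ln ((cmod (z - x))\<^sup>2) - 2 * Re ((w - z) / (z - x)))
        - (ln ((cmod ?a)\<^sup>2) - ln ((cmod ?b)\<^sup>2) - 2 * Re ((?a - ?b) / ?b)))"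
    unfolding Re_eq green_kernel_split[OF zw(1) x(1,2)] green_kernel_split[OF zw(2) x(1,3)]
      of_real_diff[symmetric]
    by (rule arg_cong[where f = complex_of_real]) simp
  hence "cmod (green_kernel w x - green_kernel z x
      - complex_of_real (2 * Re ((w - z) * green_kernel_dz z x))) \<le> ?S + ?S"
    using 1 2 by (simp only: norm_of_real)
  also have "?S + ?S = 8 * (cmod (z - w))\<^sup>2 / (cmod (z - x) * cmod (w - x))"
    by simp
  finally show ?thesis .
qed

lemma cmod_green_kernel_dz_le:
  assumes "z \<in> unit_disk" "x \<in> unit_disk" "x \<noteq> z"
  shows "cmod (green_kernel_dz z x) \<le> 2 * cmod (z - x) powr (- 1)"
proof -
  have "cmod (green_kernel_dz z x) \<le> 1 / cmod (z - x) + cmod x / cmod (1 - z * cnj x)"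
    unfolding green_kernel_dz_def
    by (rule order_trans[OF norm_triangle_ineq]) (simp add: norm_divide)
  also have "\<dots> \<le> 1 / cmod (z - x) + 1 / cmod (z - x)"
    using assms cmod_diff_le_reflected by (intro add_mono frac_le) auto
  finally show ?thesis using assms by (simp add: powr_minus_divide)
qed

lemma cmod_green_kernel_dz_diff_le:
  assumes zw: "z \<in> unit_disk" "w \<in> unit_disk" and x: "x \<in> unit_disk" "x \<noteq> z" "x \<noteq> w"
  shows "cmod (green_kernel_dz z x - green_kernel_dz w x)
    \<le> 2 * cmod (z - w) / (cmod (z - x) * cmod (w - x))"
proof -
  let ?a = "1 - z * cnj x" and ?b = "1 - w * cnj x"
  have nz: "?a \<noteq> 0" "?b \<noteq> 0"
    by (rule reflected_neq_0[OF zw(1) x(1)], rule reflected_neq_0[OF zw(2) x(1)])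
  have "green_kernel_dz z x - green_kernel_dz w x
      = (1 / (z - x) - 1 / (w - x)) + (cnj x / ?a - cnj x / ?b)"
    by (simp add: green_kernel_dz_def)
  also have "1 / (z - x) - 1 / (w - x) = (w - z) / ((z - x) * (w - x))"
    using x by (simp add: field_simps)
  also have "cnj x / ?a - cnj x / ?b = (z - w) * (cnj x)\<^sup>2 / (?a * ?b)"
    using nz by (simp add: divide_simps) (simp add: power2_eq_square algebra_simps)
  finally have "cmod (green_kernel_dz z x - green_kernel_dz w x)
      \<le> cmod (z - w) / (cmod (z - x) * cmod (w - x))
        + cmod (z - w) * (cmod x)\<^sup>2 / (cmod ?a * cmod ?b)"
    by (metis (no_types, lifting) complex_mod_cnj norm_divide norm_minus_commute norm_mult
        norm_power norm_triangle_ineq)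
  also have "cmod (z - w) * (cmod x)\<^sup>2 / (cmod ?a * cmod ?b)
      \<le> cmod (z - w) / (cmod (z - x) * cmod (w - x))"
    using zw x cmod_diff_le_reflected
    by (intro frac_le mult_mono mult_left_le) (auto simp: power_le_one)
  finally show ?thesis by (simp add: mult.commute)
qed

section \<open>Consequences of a Hoelder estimate\<close>

lemma Holder_quotient_bdd_above:
  fixes f :: "complex \<Rightarrow> 'b :: real_normed_vector"
  assumes "\<And>z w. z \<in> unit_disk \<Longrightarrow> w \<in> unit_disk \<Longrightarrow> z \<noteq> w \<Longrightarrow> norm (f z - f w) \<le> C * cmod (z - w) powr \<mu>"
  shows "bdd_above {norm (f z - f w) / cmod (z - w) powr \<mu> |z w.
       z \<in> unit_disk \<and> w \<in> unit_disk \<and> z \<noteq> w}"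
  using assms by (intro bdd_aboveI[where M = C]) (auto simp: divide_le_eq)

lemma Holder_imp_continuous_on:
  fixes f :: "complex \<Rightarrow> 'b :: real_normed_vector"
  assumes "0 < \<mu>"
    and "\<And>z w. z \<in> S \<Longrightarrow> w \<in> S \<Longrightarrow> z \<noteq> w \<Longrightarrow> norm (f z - f w) \<le> C * cmod (z - w) powr \<mu>"
  shows "continuous_on S f"
  unfolding continuous_on_def
proof
  fix w assume w: "w \<in> S"
  have "((\<lambda>z. C * cmod (z - w) powr \<mu>) \<longlongrightarrow> C * cmod (w - w) powr \<mu>) (at w within S)"
    using assms(1) by (intro tendsto_intros tendsto_powr') auto
  hence "((\<lambda>z. C * cmod (z - w) powr \<mu>) \<longlongrightarrow> 0) (at w within S)"
    by simp
  moreover have "eventually (\<lambda>z. norm (f z - f w) \<le> C * cmod (z - w) powr \<mu>) (at w within S)"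
    using assms(2) w by (auto simp: eventually_at_filter)
  ultimately have "((\<lambda>z. f z - f w) \<longlongrightarrow> 0) (at w within S)"
    by (rule Lim_null_comparison[rotated])
  thus "(f \<longlongrightarrow> f w) (at w within S)"
    by (rule LIM_zero_cancel)
qed

text \<open>The open set localises the remainder estimate, which for the Green potential is only available
  inside the disk.\<close>

lemma has_derivative_of_powr_remainder:
  fixes f :: "complex \<Rightarrow> 'b :: real_normed_vector"
  assumes "0 < \<nu>" "open S" "z \<in> S" "bounded_linear F"
    and "\<And>w. w \<in> S \<Longrightarrow> w \<noteq> z \<Longrightarrow> norm (f w - f z - F (w - z)) \<le> C * cmod (z - w) powr (1 + \<nu>)"
  shows "(f has_derivative F) (at z)"
proof -
  obtain e where e: "0 < e" "ball z e \<subseteq> S"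
    using assms(2,3) open_contains_ball by blast
  show ?thesis
  proof (rule has_derivativeI_sandwich[OF e(1) assms(4)])
    fix w assume w: "w \<noteq> z" "dist w z < e"
    hence "norm (f w - f z - F (w - z)) \<le> C * cmod (z - w) powr (1 + \<nu>)"
      using e(2) by (intro assms(5)) (auto simp: dist_commute)
    also have "\<dots> = C * cmod (z - w) powr \<nu> * norm (w - z)"
      using w by (simp add: powr_add norm_minus_commute)
    finally show "norm (f w - f z - F (w - z)) / norm (w - z) \<le> C * cmod (z - w) powr \<nu>"
      using w by (simp add: divide_le_eq)
  next
    have "((\<lambda>w. C * cmod (z - w) powr \<nu>) \<longlongrightarrow> C * cmod (z - z) powr \<nu>) (at z)"
      using assms(1) by (intro tendsto_intros tendsto_powr') auto
    thus "((\<lambda>w. C * cmod (z - w) powr \<nu>) \<longlongrightarrow> 0) (at z)"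
      by simp
  qed
qed

section \<open>Regularity of the Green potential\<close>

lemma green_potential_eq:
  "green_potential g z = (LINT x|area_measure. green_kernel z x * g x)"
  by (simp add: green_potential_def green_kernel_def)

lemma integrable_green_kernel:
  assumes "1 < p" "g \<in> Lp_disk p" "z \<in> unit_disk"
  shows "integrable area_measure (\<lambda>x. green_kernel z x * g x)"
proof -
  \<comment> \<open>The kernel is bounded by a multiple of any negative power of the distance; this one is integrable to the
    conjugate exponent, where it becomes the power \<open>- 1\<close>.\<close>
  define \<epsilon> where "\<epsilon> = (p - 1) / p"
  have e: "0 < \<epsilon>" "\<epsilon> * (p / (p - 1)) < 2"
    using assms by (auto simp: \<epsilon>_def)
  obtain D where D: "\<And>z w K c. z \<in> unit_disk \<Longrightarrow> w \<in> unit_disk \<Longrightarrow>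
      K \<in> borel_measurable area_measure \<Longrightarrow> 0 < c \<Longrightarrow>
      AE x in area_measure. cmod (K x) \<le> c * (cmod (z - x) powr (- \<epsilon>) + cmod (w - x) powr (- \<epsilon>)) \<Longrightarrow>
      integrable area_measure (\<lambda>x. K x * g x) \<and> cmod (LINT x|area_measure. K x * g x) \<le> D * c"
    by (rule Lp_pairing_bound_two_points[OF assms(1,2) less_imp_le[OF e(1)] e(2)]) blast
  have bound: "AE x in area_measure. cmod (green_kernel z x)
      \<le> 2 * 2 powr \<epsilon> / \<epsilon> * (cmod (z - x) powr (- \<epsilon>) + cmod (z - x) powr (- \<epsilon>))"
    using AE_area_disk_off[of z z]
  proof eventually_elim
    case (elim x)
    have "cmod (green_kernel z x) \<le> 2 * 2 powr \<epsilon> / \<epsilon> * cmod (z - x) powr (- \<epsilon>)"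
      using elim assms e by (intro cmod_green_kernel_le) auto
    also have "\<dots> \<le> 2 * 2 powr \<epsilon> / \<epsilon> * (cmod (z - x) powr (- \<epsilon>) + cmod (z - x) powr (- \<epsilon>))"
      using e by (intro mult_left_mono) auto
    finally show ?case .
  qed
  have "0 < 2 * 2 powr \<epsilon> / \<epsilon>" using e by simp
  from D[OF assms(3,3) borel_measurable_green_kernel(1) this bound] show ?thesis ..
qed

lemma integrable_green_kernel_dz:
  assumes "2 < p" "g \<in> Lp_disk p" "z \<in> unit_disk"
  shows "integrable area_measure (\<lambda>x. green_kernel_dz z x * g x)"
proof -
  have e: "1 < p" "(0::real) \<le> 1" "1 * (p / (p - 1)) < 2"
    using assms by (auto simp: field_simps)
  obtain D where D: "\<And>z w K c. z \<in> unit_disk \<Longrightarrow> w \<in> unit_disk \<Longrightarrow>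
      K \<in> borel_measurable area_measure \<Longrightarrow> 0 < c \<Longrightarrow>
      AE x in area_measure. cmod (K x) \<le> c * (cmod (z - x) powr (- 1) + cmod (w - x) powr (- 1)) \<Longrightarrow>
      integrable area_measure (\<lambda>x. K x * g x) \<and> cmod (LINT x|area_measure. K x * g x) \<le> D * c"
    by (rule Lp_pairing_bound_two_points[OF e(1) assms(2) e(2,3)]) blast
  have bound: "AE x in area_measure. cmod (green_kernel_dz z x)
      \<le> 2 * (cmod (z - x) powr (- 1) + cmod (z - x) powr (- 1))"
    using AE_area_disk_off[of z z]
  proof eventually_elim
    case (elim x)
    have "cmod (green_kernel_dz z x) \<le> 2 * cmod (z - x) powr (- 1)"
      using elim assms by (intro cmod_green_kernel_dz_le) auto
    also have "\<dots> \<le> 2 * (cmod (z - x) powr (- 1) + cmod (z - x) powr (- 1))"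
      by (intro mult_left_mono add_increasing2 powr_ge_zero order_refl) simp
    finally show ?case .
  qed
  show ?thesis
    by (rule D[OF assms(3,3) borel_measurable_green_kernel(2) zero_less_numeral bound, THEN conjunct1])
qed

text \<open>With \<open>\<mu> = 2 / p - 1\<close> and \<open>q = p / (p - 1)\<close> one has \<open>\<mu> q = (2 - p) / (p - 1) < 1\<close> as \<open>p > 3 / 2\<close>. So
  \<open>\<bar>z - x\<bar>\<^bsup>- \<mu>\<^esup>\<close> pairs with \<open>g\<close>, and the Hoelder bound on the kernel passes to the potential.\<close>

lemma green_potential_Holder:
  assumes p: "3 / 2 < p" "p < 2" and g: "g \<in> Lp_disk p"
  shows "green_potential g \<in> holder_disk (2 / p - 1)"
proof -
  define \<mu> where "\<mu> = 2 / p - 1"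
  have mu: "0 < \<mu>" "\<mu> \<le> 1" "\<mu> * (p / (p - 1)) < 2" and p1: "1 < p"
    using p by (auto simp: \<mu>_def field_simps)
  obtain D where D: "\<And>z w K c. z \<in> unit_disk \<Longrightarrow> w \<in> unit_disk \<Longrightarrow>
      K \<in> borel_measurable area_measure \<Longrightarrow> 0 < c \<Longrightarrow>
      AE x in area_measure. cmod (K x) \<le> c * (cmod (z - x) powr (- \<mu>) + cmod (w - x) powr (- \<mu>)) \<Longrightarrow>
      integrable area_measure (\<lambda>x. K x * g x) \<and> cmod (LINT x|area_measure. K x * g x) \<le> D * c"
    by (rule Lp_pairing_bound_two_points[OF p1 g less_imp_le[OF mu(1)] mu(3)]) blast
  have Holder: "cmod (green_potential g z - green_potential g w) \<le> D * (8 / \<mu>) * cmod (z - w) powr \<mu>"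
    if zw: "z \<in> unit_disk" "w \<in> unit_disk" "z \<noteq> w" for z w
  proof -
    let ?K = "\<lambda>x. green_kernel z x - green_kernel w x"
    have "green_potential g z - green_potential g w
        = (LINT x|area_measure. green_kernel z x * g x - green_kernel w x * g x)"
      unfolding green_potential_eq
      by (intro Bochner_Integration.integral_diff[symmetric] integrable_green_kernel[OF p1 g] zw)
    also have "\<dots> = (LINT x|area_measure. ?K x * g x)"
      by (simp add: left_diff_distrib)
    also have "cmod \<dots> \<le> D * (8 / \<mu> * cmod (z - w) powr \<mu>)"
    proof (intro D[THEN conjunct2] zw)
      show "?K \<in> borel_measurable area_measure"
        by (intro borel_measurable_diff borel_measurable_green_kernel)
      show "AE x in area_measure. cmod (?K x) \<le> 8 / \<mu> * cmod (z - w) powr \<mu> *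
          (cmod (z - x) powr (- \<mu>) + cmod (w - x) powr (- \<mu>))"
        using AE_area_disk_off[of z w]
      proof eventually_elim
        case (elim x)
        with zw mu show ?case by (intro cmod_green_kernel_diff_le) auto
      qed
    qed (use zw mu in auto)
    finally show ?thesis by simp
  qed
  show ?thesis
    using Holder_quotient_bdd_above[OF Holder] Holder_imp_continuous_on[where S = unit_disk, OF mu(1) Holder]
    by (simp add: holder_disk_def \<mu>_def)
qed

text \<open>The remainder of the kernel is of size \<open>t\<^sup>2\<close>, and the difference of its derivatives of size \<open>t\<close>, times
  \<open>1 / (\<bar>z - x\<bar> \<bar>w - x\<bar>)\<close> with \<open>t = \<bar>z - w\<bar>\<close>. Pairing with \<open>g\<close> costs \<open>t\<^bsup>- 2 / p\<^esup>\<close>, which leaves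
  \<open>t\<^bsup>1 + \<nu>\<^esup>\<close> and \<open>t\<^bsup>\<nu>\<^esup>\<close>: differentiability and the Hoelder estimate of the gradient come out of one and
  the same integral.\<close>

lemma green_potential_C1_Holder:
  assumes p: "2 < p" and g: "g \<in> Lp_disk p"
  shows "green_potential g \<in> C1_holder_disk (1 - 2 / p)"
proof -
  define \<nu> where "\<nu> = 1 - 2 / p"
  have nu: "0 < \<nu>" and p1: "1 < p"
    using p by (auto simp: \<nu>_def field_simps)
  obtain D where D:
    "\<And>z w K c. z \<noteq> w \<Longrightarrow> K \<in> borel_measurable area_measure \<Longrightarrow> 0 < c \<Longrightarrow>
      AE x in area_measure. cmod (K x) \<le> c / (cmod (z - x) * cmod (w - x)) \<Longrightarrow>
      integrable area_measure (\<lambda>x. K x * g x) \<and>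
      cmod (LINT x|area_measure. K x * g x) \<le> D * (c * cmod (z - w) powr (- 2 / p))"
    by (rule Lp_pairing_bound_pair[OF p g]) blast
  have scale: "t * t powr (- 2 / p) = t powr \<nu>" "t\<^sup>2 * t powr (- 2 / p) = t powr (1 + \<nu>)" if "0 < t" for t
  proof -
    have "t * t powr (- 2 / p) = t powr 1 * t powr (- 2 / p)" using that by simp
    thus "t * t powr (- 2 / p) = t powr \<nu>" unfolding powr_add[symmetric] by (simp add: \<nu>_def)
    have "t\<^sup>2 * t powr (- 2 / p) = t powr 2 * t powr (- 2 / p)" using that by simp
    thus "t\<^sup>2 * t powr (- 2 / p) = t powr (1 + \<nu>)" unfolding powr_add[symmetric] by (simp add: \<nu>_def)
  qed

  \<comment> \<open>\<open>T z h\<close> differentiates under the integral sign in the direction \<open>h\<close>: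
    the derivative of \<open>ln \<bar>f\<bar>\<^sup>2\<close> along \<open>h\<close> is \<open>2 Re (h f' / f)\<close> for holomorphic \<open>f\<close>.\<close>
  define T where
    "T = (\<lambda>z h. LINT x|area_measure. complex_of_real (2 * Re (h * green_kernel_dz z x)) * g x)"
  have K_meas: "(\<lambda>x. complex_of_real (2 * Re (h * green_kernel_dz z x))) \<in> borel_measurable area_measure"
    for h z
    using borel_measurable_green_kernel(2)[of z] by measurable
  have T_int: "integrable area_measure (\<lambda>x. complex_of_real (2 * Re (h * green_kernel_dz z x)) * g x)"
    if z: "z \<in> unit_disk" for z h
  proof (rule Bochner_Integration.integrable_bound)
    show "integrable area_measure (\<lambda>x. complex_of_real (2 * cmod h) * (green_kernel_dz z x * g x))"
      by (intro integrable_mult_right integrable_green_kernel_dz[OF p g z])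
    show "(\<lambda>x. complex_of_real (2 * Re (h * green_kernel_dz z x)) * g x) \<in> borel_measurable area_measure"
      using K_meas g by (intro borel_measurable_times) (auto simp: Lp_disk_def)
    have "\<bar>2 * Re (h * green_kernel_dz z x)\<bar> * cmod (g x)
        \<le> 2 * cmod h * cmod (green_kernel_dz z x) * cmod (g x)" for x
      using abs_Re_le_cmod[of "h * green_kernel_dz z x"]
      by (intro mult_right_mono) (auto simp: norm_mult abs_mult)
    thus "AE x in area_measure. norm (complex_of_real (2 * Re (h * green_kernel_dz z x)) * g x)
        \<le> norm (complex_of_real (2 * cmod h) * (green_kernel_dz z x * g x))"
      by (intro AE_I2) (simp only: norm_mult norm_of_real abs_mult abs_numeral abs_norm_cancel mult.assoc)
  qed
  have T_lin: "T z h = of_real (Re h) * T z 1 + of_real (Im h) * T z \<i>" if z: "z \<in> unit_disk" for z h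
  proof -
    have "T z h = (LINT x|area_measure.
        of_real (Re h) * (complex_of_real (2 * Re (1 * green_kernel_dz z x)) * g x) +
        of_real (Im h) * (complex_of_real (2 * Re (\<i> * green_kernel_dz z x)) * g x))"
      unfolding T_def by (intro Bochner_Integration.integral_cong) (simp_all add: algebra_simps)
    also have "\<dots> = of_real (Re h) * T z 1 + of_real (Im h) * T z \<i>"
      unfolding T_def
      by (subst Bochner_Integration.integral_add) (intro integrable_mult_right T_int z | simp)+
    finally show ?thesis .
  qed
  have T_bl: "bounded_linear (T z)" if "z \<in> unit_disk" for z
  proof -
    have "bounded_linear (\<lambda>h. of_real (Re h) * T z 1 + of_real (Im h) * T z \<i>)"
      by (intro bounded_linear_add bounded_linear_mult_const bounded_linear_compose[OF bounded_linear_of_real]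
          bounded_linear_Re bounded_linear_Im)
    moreover have "T z = (\<lambda>h. of_real (Re h) * T z 1 + of_real (Im h) * T z \<i>)"
      by (rule ext) (rule T_lin[OF that])
    ultimately show ?thesis
      by (rule ssubst[rotated, where P = bounded_linear])
  qed

  have deriv: "(green_potential g has_derivative T z) (at z)" if z: "z \<in> unit_disk" for z
  proof (rule has_derivative_of_powr_remainder[OF nu open_ball z T_bl[OF z]])
    fix w assume w: "w \<in> unit_disk" "w \<noteq> z"
    let ?K = "\<lambda>x. green_kernel w x - green_kernel z x
        - complex_of_real (2 * Re ((w - z) * green_kernel_dz z x))"
    have "green_potential g w - green_potential g z - T z (w - z) = (LINT x|area_measure. ?K x * g x)"
      unfolding green_potential_eq T_def left_diff_distrib[where c = "g x" for x]
      by (simp only: Bochner_Integration.integral_diff Bochner_Integration.integrable_diff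
          integrable_green_kernel[OF p1 g] z w T_int[OF z])
    also have "cmod \<dots> \<le> D * (8 * (cmod (z - w))\<^sup>2 * cmod (z - w) powr (- 2 / p))"
    proof (intro D[THEN conjunct2])
      show "?K \<in> borel_measurable area_measure"
        by (intro borel_measurable_diff borel_measurable_green_kernel K_meas)
      show "AE x in area_measure. cmod (?K x) \<le> 8 * (cmod (z - w))\<^sup>2 / (cmod (z - x) * cmod (w - x))"
        using AE_area_disk_off[of z w]
      proof eventually_elim
        case (elim x)
        with z w show ?case by (intro green_kernel_taylor) auto
      qed
    qed (use w in auto)
    also have "\<dots> = 8 * D * cmod (z - w) powr (1 + \<nu>)"
      using w scale(2)[of "cmod (z - w)"] by simp
    finally show "cmod (green_potential g w - green_potential g z - T z (w - z))
        \<le> 8 * D * cmod (z - w) powr (1 + \<nu>)" .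
  qed
  have grad_eq: "grad (green_potential g) z = (T z 1, T z \<i>)" if "z \<in> unit_disk" for z
    using frechet_derivative_at[OF deriv[OF that]] by (simp add: grad_def)

  have T_Holder: "cmod (T z h - T w h) \<le> 4 * D * cmod (z - w) powr \<nu>"
    if zw: "z \<in> unit_disk" "w \<in> unit_disk" "z \<noteq> w" and h: "cmod h = 1" for z w h
  proof -
    let ?K = "\<lambda>x. complex_of_real (2 * Re (h * green_kernel_dz z x))
        - complex_of_real (2 * Re (h * green_kernel_dz w x))"
    have "T z h - T w h = (LINT x|area_measure. ?K x * g x)"
      unfolding T_def left_diff_distrib[where c = "g x" for x]
      by (simp only: Bochner_Integration.integral_diff T_int zw)
    also have "cmod \<dots> \<le> D * (4 * cmod (z - w) * cmod (z - w) powr (- 2 / p))"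
    proof (intro D[THEN conjunct2])
      show "?K \<in> borel_measurable area_measure"
        by (intro borel_measurable_diff K_meas)
      show "AE x in area_measure. cmod (?K x) \<le> 4 * cmod (z - w) / (cmod (z - x) * cmod (w - x))"
        using AE_area_disk_off[of z w]
      proof eventually_elim
        case (elim x)
        have "?K x = complex_of_real (2 * Re (h * (green_kernel_dz z x - green_kernel_dz w x)))"
          by (simp add: right_diff_distrib)
        hence "cmod (?K x) = 2 * \<bar>Re (h * (green_kernel_dz z x - green_kernel_dz w x))\<bar>"
          by (simp only: norm_of_real abs_mult abs_numeral)
        also have "\<dots> \<le> 2 * cmod (green_kernel_dz z x - green_kernel_dz w x)"
          using abs_Re_le_cmod[of "h * (green_kernel_dz z x - green_kernel_dz w x)"] h
          by (simp add: norm_mult)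
        also have "\<dots> \<le> 2 * (2 * cmod (z - w) / (cmod (z - x) * cmod (w - x)))"
          using elim zw by (intro mult_left_mono cmod_green_kernel_dz_diff_le) auto
        finally show ?case by simp
      qed
    qed (use zw in auto)
    also have "\<dots> = 4 * D * cmod (z - w) powr \<nu>"
      using zw scale(1)[of "cmod (z - w)"] by simp
    finally show ?thesis .
  qed
  have grad_Holder: "norm (grad (green_potential g) z - grad (green_potential g) w)
      \<le> 8 * D * cmod (z - w) powr \<nu>" if zw: "z \<in> unit_disk" "w \<in> unit_disk" "z \<noteq> w" for z w
  proof -
    have "norm (grad (green_potential g) z - grad (green_potential g) w)
        \<le> cmod (T z 1 - T w 1) + cmod (T z \<i> - T w \<i>)"
      using zw norm_Pair_le[of "T z 1 - T w 1" "T z \<i> - T w \<i>"] by (simp add: grad_eq)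
    also have "\<dots> \<le> 4 * D * cmod (z - w) powr \<nu> + 4 * D * cmod (z - w) powr \<nu>"
      using zw by (intro add_mono T_Holder) auto
    finally show ?thesis by simp
  qed
  have "green_potential g \<in> C1_disk"
    using deriv Holder_imp_continuous_on[where S = unit_disk, OF nu grad_Holder]
    by (auto simp: C1_disk_def intro: differentiableI[OF deriv])
  thus ?thesis
    using Holder_quotient_bdd_above[OF grad_Holder] by (simp add: C1_holder_disk_def \<nu>_def)
qed

theorem theorem1p2:
  fixes p :: real and g :: "complex \<Rightarrow> complex"
  assumes "3 / 2 < p" and "g \<in> Lp_disk p"
  shows "(p < 2 \<longrightarrow> green_potential g \<in> holder_disk (2 / p - 1)) \<and>
         (2 < p \<longrightarrow> green_potential g \<in> C1_holder_disk (1 - 2 / p))"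
  using assms green_potential_Holder green_potential_C1_Holder by blast

end
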